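(* For each $n\in\mathbb{N}$, the property of $n$-almost divisibility is separably determined for $\mathrm{Cu}$-semigroups.
   Context: A $\mathrm{Cu}$-semigroup is a positively ordered (commutative) monoid $S$ (partial order compatible with addition, $0\leq x$ for all $x$) such that: (O1) increasing sequences have suprema; (O2) every element is the supremum of a sequence $(x_n)_n$ with $x_n\ll x_{n+1}$; (O3) $x'\ll x$ and $y'\ll y$ imply $x'+y'\ll x+y$; (O4) $\sup_n(x_n+y_n)=\sup_n x_n+\sup_n y_n$ for increasing sequences. Here $x\ll y$ means: for every increasing sequence $(y_n)_n$ with $y\leq\sup_n y_n$ there is $n$ with $x\leq y_n$. A $\mathrm{Cu}$-morphism is an order-preserving monoid morphism that preserves suprema of increasing sequences and the relation $\ll$. A submonoid $H\subseteq S$ is a sub-$\mathrm{Cu}$-semigroup if it is a $\mathrm{Cu}$-semigroup with the induced order and the inclusion $H\to S$ is a $\mathrm{Cu}$-morphism. $S$ is separable if it has a countable subset $B$ such that every element of $S$ is the supremum of an increasing sequence in $B$. $\mathrm{Sep}(S)$ is the family of separable sub-$\mathrm{Cu}$-semigroups of $S$, ordered by inclusion; every countable directed subset $\mathcal{D}'$ has a supremum in $\mathrm{Sep}(S)$, namely the set of suprema in $S$ of increasing sequences in $\bigcup\mathcal{D}'$. A family $\mathcal{D}\subseteq\mathrm{Sep}(S)$ is a club if it is cofinal (every $T_0\in\mathrm{Sep}(S)$ is contained in some $T\in\mathcal{D}$) and $\sigma$-complete ($\sup\mathcal{D}'\in\mathcal{D}$ for every countable directed $\mathcal{D}'\subseteq\mathcal{D}$).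 A property $\mathcal{P}$ of $\mathrm{Cu}$-semigroups satisfies the Löwenheim-Skolem condition if for every $\mathrm{Cu}$-semigroup $S$ with $\mathcal{P}$ there is a club in $\mathrm{Sep}(S)$ all of whose members have $\mathcal{P}$. It is separably determined if it satisfies the Löwenheim-Skolem condition and passes to inductive limits (in the category of $\mathrm{Cu}$-semigroups and $\mathrm{Cu}$-morphisms, over arbitrary directed index sets). $S$ is $n$-almost divisible if for any $k\in\mathbb{N}$ and $x'\ll x$ in $S$ there is $y\in S$ with $ky\leq x$ and $x'\leq(k+1)(n+1)y$ ($\mathbb{N}$ includes $0$). *)

theory Defs
  imports "HOL-Algebra.Group" "HOL-Library.Countable_Set"
begin

section \<open>Cu-semigroups\<close>

text \<open>
  The additive monoids of the theory are written with the multiplicative notation of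
  HOL-Algebra: \<open>x \<otimes> y\<close> is \<open>x + y\<close>, \<open>\<one>\<close> is \<open>0\<close>, and \<open>x [^] k\<close> is \<open>k x\<close>.
  Only the restriction of the order to the carrier is meaningful.
\<close>

record 'a po_monoid = "'a monoid" +
  leq :: "'a \<Rightarrow> 'a \<Rightarrow> bool" (infixl "\<preceq>\<index>" 50)

locale positively_ordered_monoid = comm_monoid S for S (structure) +
  assumes leq_refl: "x \<in> carrier S \<Longrightarrow> x \<preceq> x"
    and leq_antisym: "\<lbrakk>x \<in> carrier S; y \<in> carrier S; x \<preceq> y; y \<preceq> x\<rbrakk> \<Longrightarrow> x = y"
    and leq_trans: "\<lbrakk>x \<in> carrier S; y \<in> carrier S; z \<in> carrier S; x \<preceq> y; y \<preceq> z\<rbrakk> \<Longrightarrow> x \<preceq> z"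
    and leq_add: "\<lbrakk>x \<in> carrier S; y \<in> carrier S; z \<in> carrier S; x \<preceq> y\<rbrakk> \<Longrightarrow> x \<otimes> z \<preceq> y \<otimes> z"
    and zero_leq: "x \<in> carrier S \<Longrightarrow> \<one> \<preceq> x"

definition increasing :: "('a, 'm) po_monoid_scheme \<Rightarrow> (nat \<Rightarrow> 'a) \<Rightarrow> bool" where
  "increasing S x \<longleftrightarrow> (\<forall>n. x n \<in> carrier S) \<and> (\<forall>n. x n \<preceq>\<^bsub>S\<^esub> x (Suc n))"

definition seq_sup :: "('a, 'm) po_monoid_scheme \<Rightarrow> (nat \<Rightarrow> 'a) \<Rightarrow> 'a \<Rightarrow> bool" where
  "seq_sup S x s \<longleftrightarrow> s \<in> carrier S \<and> (\<forall>n. x n \<preceq>\<^bsub>S\<^esub> s) \<and>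
     (\<forall>u\<in>carrier S. (\<forall>n. x n \<preceq>\<^bsub>S\<^esub> u) \<longrightarrow> s \<preceq>\<^bsub>S\<^esub> u)"

definition way_below :: "('a, 'm) po_monoid_scheme \<Rightarrow> 'a \<Rightarrow> 'a \<Rightarrow> bool" (infixl "\<lless>\<index>" 50) where
  "x \<lless>\<^bsub>S\<^esub> y \<longleftrightarrow> x \<in> carrier S \<and> y \<in> carrier S \<and>
     (\<forall>z s. increasing S z \<and> seq_sup S z s \<and> y \<preceq>\<^bsub>S\<^esub> s \<longrightarrow> (\<exists>n. x \<preceq>\<^bsub>S\<^esub> z n))"

locale cu_semigroup = positively_ordered_monoid +
  assumes O1: "increasing S x \<Longrightarrow> \<exists>s. seq_sup S x s"
    and O2: "s \<in> carrier S \<Longrightarrow> \<exists>x. (\<forall>n. x n \<lless> x (Suc n)) \<and> seq_sup S x s"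
    and O3: "\<lbrakk>a' \<lless> a; b' \<lless> b\<rbrakk> \<Longrightarrow> a' \<otimes> b' \<lless> a \<otimes> b"
    and O4: "\<lbrakk>increasing S x; increasing S y; seq_sup S x s; seq_sup S y t\<rbrakk> \<Longrightarrow>
               seq_sup S (\<lambda>n. x n \<otimes> y n) (s \<otimes> t)"

definition cu_morphism ::
    "('a, 'm) po_monoid_scheme \<Rightarrow> ('b, 'n) po_monoid_scheme \<Rightarrow> ('a \<Rightarrow> 'b) \<Rightarrow> bool" where
  "cu_morphism S T f \<longleftrightarrow>
     f \<in> hom S T \<and> f \<one>\<^bsub>S\<^esub> = \<one>\<^bsub>T\<^esub> \<and>
     (\<forall>x\<in>carrier S. \<forall>y\<in>carrier S. x \<preceq>\<^bsub>S\<^esub> y \<longrightarrow> f x \<preceq>\<^bsub>T\<^esub> f y) \<and>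
     (\<forall>x s. increasing S x \<and> seq_sup S x s \<longrightarrow> seq_sup T (\<lambda>n. f (x n)) (f s)) \<and>
     (\<forall>x y. x \<lless>\<^bsub>S\<^esub> y \<longrightarrow> f x \<lless>\<^bsub>T\<^esub> f y)"


section \<open>Separable sub-Cu-semigroups and clubs\<close>

definition sub_cu_semigroup :: "'a set \<Rightarrow> ('a, 'm) po_monoid_scheme \<Rightarrow> bool" where
  "sub_cu_semigroup H S \<longleftrightarrow> submonoid H S \<and> cu_semigroup (S\<lparr>carrier := H\<rparr>) \<and>
     cu_morphism (S\<lparr>carrier := H\<rparr>) S (\<lambda>x. x)"

definition cu_separable :: "('a, 'm) po_monoid_scheme \<Rightarrow> bool" where
  "cu_separable S \<longleftrightarrow> (\<exists>B\<subseteq>carrier S. countable B \<and>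
     (\<forall>s\<in>carrier S. \<exists>x. range x \<subseteq> B \<and> increasing S x \<and> seq_sup S x s))"

definition Sep :: "('a, 'm) po_monoid_scheme \<Rightarrow> 'a set set" where
  "Sep S = {T. sub_cu_semigroup T S \<and> cu_separable (S\<lparr>carrier := T\<rparr>)}"

definition directed_family :: "'a set set \<Rightarrow> bool" where
  "directed_family D \<longleftrightarrow> D \<noteq> {} \<and> (\<forall>A\<in>D. \<forall>B\<in>D. \<exists>C\<in>D. A \<subseteq> C \<and> B \<subseteq> C)"

definition seq_closure :: "('a, 'm) po_monoid_scheme \<Rightarrow> 'a set \<Rightarrow> 'a set" where
  "seq_closure S M = {s. \<exists>x. range x \<subseteq> M \<and> increasing S x \<and> seq_sup S x s}"

text \<open>
  That this is the least upper bound in \<open>Sep S\<close> of a countable directed family \<open>D\<close>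
  is shown in \<open>Sep_sup_in_Sep\<close>, \<open>Sep_sup_upper\<close> and \<open>Sep_sup_least\<close> below.
\<close>

definition Sep_sup :: "('a, 'm) po_monoid_scheme \<Rightarrow> 'a set set \<Rightarrow> 'a set" where
  "Sep_sup S D = seq_closure S (\<Union>D)"

definition club :: "('a, 'm) po_monoid_scheme \<Rightarrow> 'a set set \<Rightarrow> bool" where
  "club S D \<longleftrightarrow> D \<subseteq> Sep S \<and>
     (\<forall>T0\<in>Sep S. \<exists>T\<in>D. T0 \<subseteq> T) \<and>
     (\<forall>D'\<subseteq>D. countable D' \<and> directed_family D' \<longrightarrow> Sep_sup S D' \<in> D)"


section \<open>Inductive limits\<close>

definition directed_index :: "'i set \<Rightarrow> ('i \<Rightarrow> 'i \<Rightarrow> bool) \<Rightarrow> bool" where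
  "directed_index I r \<longleftrightarrow> I \<noteq> {} \<and> (\<forall>i\<in>I. r i i) \<and>
     (\<forall>i\<in>I. \<forall>j\<in>I. \<forall>k\<in>I. r i j \<and> r j k \<longrightarrow> r i k) \<and>
     (\<forall>i\<in>I. \<forall>j\<in>I. \<exists>k\<in>I. r i k \<and> r j k)"

definition inductive_system ::
    "'i set \<Rightarrow> ('i \<Rightarrow> 'i \<Rightarrow> bool) \<Rightarrow> ('i \<Rightarrow> 'a po_monoid) \<Rightarrow> ('i \<Rightarrow> 'i \<Rightarrow> 'a \<Rightarrow> 'a) \<Rightarrow> bool" where
  "inductive_system I r S \<phi> \<longleftrightarrow> directed_index I r \<and>
     (\<forall>i\<in>I. cu_semigroup (S i)) \<and>
     (\<forall>i\<in>I. \<forall>j\<in>I. r i j \<longrightarrow> cu_morphism (S i) (S j) (\<phi> i j)) \<and>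
     (\<forall>i\<in>I. \<forall>x\<in>carrier (S i). \<phi> i i x = x) \<and>
     (\<forall>i\<in>I. \<forall>j\<in>I. \<forall>k\<in>I. r i j \<and> r j k \<longrightarrow>
        (\<forall>x\<in>carrier (S i). \<phi> j k (\<phi> i j x) = \<phi> i k x))"

definition cocone ::
    "'i set \<Rightarrow> ('i \<Rightarrow> 'i \<Rightarrow> bool) \<Rightarrow> ('i \<Rightarrow> 'a po_monoid) \<Rightarrow> ('i \<Rightarrow> 'i \<Rightarrow> 'a \<Rightarrow> 'a) \<Rightarrow>
     'b po_monoid \<Rightarrow> ('i \<Rightarrow> 'a \<Rightarrow> 'b) \<Rightarrow> bool" where
  "cocone I r S \<phi> T g \<longleftrightarrow>
     (\<forall>i\<in>I. cu_morphism (S i) T (g i)) \<and>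
     (\<forall>i\<in>I. \<forall>j\<in>I. r i j \<longrightarrow> (\<forall>x\<in>carrier (S i). g j (\<phi> i j x) = g i x))"

text \<open>Morphisms out of \<open>L\<close> are made extensional, so that \<open>\<exists>!\<close> is uniqueness on \<open>carrier L\<close>.\<close>

definition factors_uniquely ::
    "'i set \<Rightarrow> ('i \<Rightarrow> 'i \<Rightarrow> bool) \<Rightarrow> ('i \<Rightarrow> 'a po_monoid) \<Rightarrow> ('i \<Rightarrow> 'i \<Rightarrow> 'a \<Rightarrow> 'a) \<Rightarrow>
     'b po_monoid \<Rightarrow> ('i \<Rightarrow> 'a \<Rightarrow> 'b) \<Rightarrow> 'c po_monoid \<Rightarrow> bool" where
  "factors_uniquely I r S \<phi> L f T \<longleftrightarrow>
     (\<forall>g. cocone I r S \<phi> T g \<longrightarrow>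
       (\<exists>!h. h \<in> extensional (carrier L) \<and> cu_morphism L T h \<and>
             (\<forall>i\<in>I. \<forall>x\<in>carrier (S i). h (f i x) = g i x)))"

text \<open>
  The universal property has to hold for Cu-semigroups \<open>T\<close> on arbitrary types, which a single
  formula of HOL cannot express. It is required on two types: that of \<open>L\<close>, and sets of
  sequences of elements of the system, a type large enough to carry a copy of every
  Cu-semigroup generated by a cocone. Lemma \<open>inductive_limit_universal\<close> below shows that
  the property then holds for Cu-semigroups on every type.
\<close>

definition inductive_limit ::
    "'i set \<Rightarrow> ('i \<Rightarrow> 'i \<Rightarrow> bool) \<Rightarrow> ('i \<Rightarrow> 'a po_monoid) \<Rightarrow> ('i \<Rightarrow> 'i \<Rightarrow> 'a \<Rightarrow> 'a) \<Rightarrow>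
     'b po_monoid \<Rightarrow> ('i \<Rightarrow> 'a \<Rightarrow> 'b) \<Rightarrow> bool" where
  "inductive_limit I r S \<phi> L f \<longleftrightarrow>
     inductive_system I r S \<phi> \<and> cu_semigroup L \<and> cocone I r S \<phi> L f \<and>
     (\<forall>T :: 'b po_monoid. cu_semigroup T \<longrightarrow> factors_uniquely I r S \<phi> L f T) \<and>
     (\<forall>T :: (nat \<Rightarrow> 'i \<times> 'a) set po_monoid. cu_semigroup T \<longrightarrow> factors_uniquely I r S \<phi> L f T)"


section \<open>Separably determined properties\<close>

text \<open>
  The type \<open>'a\<close> serves as universe: a property of Cu-semigroups is a predicate on those with
  carrier in \<open>'a\<close>, and index sets of inductive systems live in \<open>'i\<close>. Both are arbitrary in the
  theorem. The members of any system and its limit have isomorphic copies on a common type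
  (\<open>cu_transport\<close> below), so taking them in the same type \<open>'a\<close> is no restriction for
  isomorphism-invariant properties.
\<close>

definition Loewenheim_Skolem :: "('a po_monoid \<Rightarrow> bool) \<Rightarrow> bool" where
  "Loewenheim_Skolem P \<longleftrightarrow>
     (\<forall>S. cu_semigroup S \<and> P S \<longrightarrow> (\<exists>D. club S D \<and> (\<forall>T\<in>D. P (S\<lparr>carrier := T\<rparr>))))"

definition passes_to_inductive_limits :: "'i itself \<Rightarrow> ('a po_monoid \<Rightarrow> bool) \<Rightarrow> bool" where
  "passes_to_inductive_limits (_ :: 'i itself) P \<longleftrightarrow>
     (\<forall>(I :: 'i set) r S \<phi> L f.
        inductive_limit I r S \<phi> L f \<and> (\<forall>i\<in>I. P (S i)) \<longrightarrow> P L)"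

definition separably_determined :: "'i itself \<Rightarrow> ('a po_monoid \<Rightarrow> bool) \<Rightarrow> bool" where
  "separably_determined (ind :: 'i itself) P \<longleftrightarrow>
     Loewenheim_Skolem P \<and> passes_to_inductive_limits ind P"

definition almost_divisible :: "nat \<Rightarrow> ('a, 'm) po_monoid_scheme \<Rightarrow> bool" where
  "almost_divisible n S \<longleftrightarrow>
     (\<forall>(k::nat) x' x. x' \<lless>\<^bsub>S\<^esub> x \<longrightarrow>
        (\<exists>y\<in>carrier S. y [^]\<^bsub>S\<^esub> k \<preceq>\<^bsub>S\<^esub> x \<and> x' \<preceq>\<^bsub>S\<^esub> y [^]\<^bsub>S\<^esub> ((k + 1) * (n + 1))))"

section \<open>Adequacy of the suprema in \<open>Sep\<close> and of the universal property\<close>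

lemma increasing_carrier: "increasing S x \<Longrightarrow> x n \<in> carrier S"
  by (simp add: increasing_def)

lemma seq_sup_carrier: "seq_sup S x s \<Longrightarrow> s \<in> carrier S"
  by (simp add: seq_sup_def)

lemma seq_sup_upper: "seq_sup S x s \<Longrightarrow> x n \<preceq>\<^bsub>S\<^esub> s"
  by (simp add: seq_sup_def)

lemma seq_sup_least:
  "\<lbrakk>seq_sup S x s; u \<in> carrier S; \<And>n. x n \<preceq>\<^bsub>S\<^esub> u\<rbrakk> \<Longrightarrow> s \<preceq>\<^bsub>S\<^esub> u"
  by (simp add: seq_sup_def)

lemma way_below_carrier:
  assumes "x \<lless>\<^bsub>S\<^esub> y"
  shows "x \<in> carrier S" "y \<in> carrier S"
  using assms by (simp_all add: way_below_def)

lemma way_belowD: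
  "\<lbrakk>x \<lless>\<^bsub>S\<^esub> y; increasing S z; seq_sup S z s; y \<preceq>\<^bsub>S\<^esub> s\<rbrakk> \<Longrightarrow> \<exists>n. x \<preceq>\<^bsub>S\<^esub> z n"
  by (auto simp: way_below_def)

lemma cu_morphismD:
  assumes "cu_morphism S T f"
  shows "f \<in> hom S T" "f \<one>\<^bsub>S\<^esub> = \<one>\<^bsub>T\<^esub>"
    "\<And>x y. \<lbrakk>x \<in> carrier S; y \<in> carrier S; x \<preceq>\<^bsub>S\<^esub> y\<rbrakk> \<Longrightarrow> f x \<preceq>\<^bsub>T\<^esub> f y"
    "\<And>x s. \<lbrakk>increasing S x; seq_sup S x s\<rbrakk> \<Longrightarrow> seq_sup T (\<lambda>n. f (x n)) (f s)"
    "\<And>x y. x \<lless>\<^bsub>S\<^esub> y \<Longrightarrow> f x \<lless>\<^bsub>T\<^esub> f y"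
    "\<And>x. x \<in> carrier S \<Longrightarrow> f x \<in> carrier T"
    "\<And>x y. \<lbrakk>x \<in> carrier S; y \<in> carrier S\<rbrakk> \<Longrightarrow> f (x \<otimes>\<^bsub>S\<^esub> y) = f x \<otimes>\<^bsub>T\<^esub> f y"
  using assms by (auto simp: cu_morphism_def hom_def)

lemma cu_morphismI:
  assumes "\<And>x. x \<in> carrier S \<Longrightarrow> f x \<in> carrier T"
    "\<And>x y. \<lbrakk>x \<in> carrier S; y \<in> carrier S\<rbrakk> \<Longrightarrow> f (x \<otimes>\<^bsub>S\<^esub> y) = f x \<otimes>\<^bsub>T\<^esub> f y"
    "f \<one>\<^bsub>S\<^esub> = \<one>\<^bsub>T\<^esub>"
    "\<And>x y. \<lbrakk>x \<in> carrier S; y \<in> carrier S; x \<preceq>\<^bsub>S\<^esub> y\<rbrakk> \<Longrightarrow> f x \<preceq>\<^bsub>T\<^esub> f y"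
    "\<And>x s. \<lbrakk>increasing S x; seq_sup S x s\<rbrakk> \<Longrightarrow> seq_sup T (\<lambda>n. f (x n)) (f s)"
    "\<And>x y. x \<lless>\<^bsub>S\<^esub> y \<Longrightarrow> f x \<lless>\<^bsub>T\<^esub> f y"
  shows "cu_morphism S T f"
  using assms by (auto simp: cu_morphism_def hom_def)

lemma cu_morphism_increasing:
  "\<lbrakk>cu_morphism S T f; increasing S x\<rbrakk> \<Longrightarrow> increasing T (\<lambda>n. f (x n))"
  using cu_morphismD(3)[of S T f] cu_morphismD(6)[of S T f] by (simp add: increasing_def)

lemma cu_morphism_comp:
  assumes f: "cu_morphism S T f" and g: "cu_morphism T U g"
  shows "cu_morphism S U (\<lambda>x. g (f x))"
proof (rule cu_morphismI)
  show "seq_sup U (\<lambda>n. g (f (x n))) (g (f s))" if "increasing S x" "seq_sup S x s" for x s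
    using cu_morphismD(4)[OF g cu_morphism_increasing[OF f that(1)] cu_morphismD(4)[OF f that]] .
qed (simp_all add: cu_morphismD[OF f] cu_morphismD[OF g])

lemma cu_morphism_cong:
  assumes f: "cu_morphism S T f" and S: "positively_ordered_monoid S"
    and eq: "\<And>x. x \<in> carrier S \<Longrightarrow> f x = g x"
  shows "cu_morphism S T g"
proof -
  interpret positively_ordered_monoid S by fact
  show ?thesis
  proof (rule cu_morphismI)
    show "seq_sup T (\<lambda>n. g (x n)) (g s)" if "increasing S x" "seq_sup S x s" for x s
      using cu_morphismD(4)[OF f that] eq[OF increasing_carrier[OF that(1)]]
        eq[OF seq_sup_carrier[OF that(2)]] by simp
    show "g x \<lless>\<^bsub>T\<^esub> g y" if "x \<lless>\<^bsub>S\<^esub> y" for x y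
      using cu_morphismD(5)[OF f that] eq[OF way_below_carrier(1)[OF that]]
        eq[OF way_below_carrier(2)[OF that]] by simp
    show "g \<one>\<^bsub>S\<^esub> = \<one>\<^bsub>T\<^esub>"
      using cu_morphismD(2)[OF f] eq by simp
    show "g x \<preceq>\<^bsub>T\<^esub> g y" if "x \<in> carrier S" "y \<in> carrier S" "x \<preceq>\<^bsub>S\<^esub> y" for x y
      using cu_morphismD(3)[OF f that] eq that by simp
  qed (simp_all add: cu_morphismD[OF f] eq[symmetric])
qed

context positively_ordered_monoid
begin

lemma seq_sup_unique: "\<lbrakk>seq_sup S x s; seq_sup S x t\<rbrakk> \<Longrightarrow> s = t"
  by (meson leq_antisym seq_sup_def)

lemma increasing_mono:
  assumes "increasing S x" "m \<le> n"
  shows "x m \<preceq> x n"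
  using assms(2)
proof (induction n rule: dec_induct)
  case base
  show ?case using assms(1) by (simp add: increasing_def leq_refl)
next
  case (step n)
  then show ?case using assms(1) leq_trans unfolding increasing_def by blast
qed

lemma seq_sup_const: "s \<in> carrier S \<Longrightarrow> increasing S (\<lambda>_. s) \<and> seq_sup S (\<lambda>_. s) s"
  by (simp add: increasing_def seq_sup_def leq_refl)

lemma way_below_leq: "x \<lless> y \<Longrightarrow> x \<preceq> y"
  using way_belowD[of S x y "\<lambda>_. y" y] seq_sup_const[of y] way_below_carrier[of S x y]
  by (auto intro: leq_refl)

lemma leq_way_below_trans:
  assumes "x \<in> carrier S" "x \<preceq> y" "y \<lless> z"
  shows "x \<lless> z"
  unfolding way_below_def
proof (intro conjI allI impI)
  fix w s assume w: "increasing S w \<and> seq_sup S w s \<and> z \<preceq> s"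
  then obtain n where "y \<preceq> w n" using way_belowD[OF assms(3)] by blast
  then show "\<exists>n. x \<preceq> w n"
    using leq_trans assms(1,2) way_below_carrier[OF assms(3)] increasing_carrier w by metis
qed (use assms way_below_carrier[of S] in blast)+

lemma way_below_leq_trans:
  assumes "x \<lless> y" "y \<preceq> z" "z \<in> carrier S"
  shows "x \<lless> z"
  unfolding way_below_def
proof (intro conjI allI impI)
  fix w s assume w: "increasing S w \<and> seq_sup S w s \<and> z \<preceq> s"
  then have "y \<preceq> s"
    using leq_trans assms(2,3) way_below_carrier[OF assms(1)] seq_sup_carrier by metis
  then show "\<exists>n. x \<preceq> w n" using way_belowD[OF assms(1)] w by blast
qed (use assms way_below_carrier[of S] in blast)+

lemma way_below_increasing: "(\<And>n. x n \<lless> x (Suc n)) \<Longrightarrow> increasing S x"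
  unfolding increasing_def using way_below_leq way_below_carrier by metis

lemma way_below_sup:
  assumes "\<And>n. x n \<lless> x (Suc n)" "seq_sup S x s"
  shows "x n \<lless> s"
  using way_below_leq_trans assms seq_sup_upper seq_sup_carrier by metis

lemma leq_add_mono:
  assumes "a \<in> carrier S" "b \<in> carrier S" "c \<in> carrier S" "d \<in> carrier S" "a \<preceq> b" "c \<preceq> d"
  shows "a \<otimes> c \<preceq> b \<otimes> d"
proof -
  have "a \<otimes> c \<preceq> b \<otimes> c" using assms leq_add by blast
  moreover have "b \<otimes> c \<preceq> b \<otimes> d" using assms leq_add[of c d b] by (simp add: m_comm)
  ultimately show ?thesis using leq_trans assms by blast
qed

lemma increasing_add:
  "\<lbrakk>increasing S x; increasing S y\<rbrakk> \<Longrightarrow> increasing S (\<lambda>n. x n \<otimes> y n)"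
  by (simp add: increasing_def leq_add_mono)

lemma diagonal_sequence:
  assumes x: "increasing S x" "seq_sup S x s"
    and a: "\<And>i k. a i k \<lless> a i (Suc k)" "\<And>i. seq_sup S (a i) (x i)"
  shows "\<exists>k. (\<forall>n. a n (k n) \<lless> a (Suc n) (k (Suc n))) \<and> seq_sup S (\<lambda>n. a n (k n)) s"
proof -
  have inc: "increasing S (a i)" for i using a(1) by (rule way_below_increasing)
  have car: "a i k \<in> carrier S" for i k using inc increasing_carrier by blast
  have xcar: "x i \<in> carrier S" for i using x(1) increasing_carrier by blast
  have ax: "a i k \<lless> x j" if "i \<le> j" for i j k
    using way_below_leq_trans[OF way_below_sup[OF a(1) a(2)] increasing_mono[OF x(1) that] xcar] .
  have ex: "\<exists>k. a i m \<preceq> a j k" if "i \<le> j" for i j m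
    using way_belowD[OF ax[OF that] inc a(2) leq_refl[OF xcar]] .
  let ?P = "\<lambda>n k. \<forall>i\<le>n. a i n \<preceq> a n k"
  let ?Q = "\<lambda>n k k'. a n k \<lless> a (Suc n) k'"
  have "\<exists>k. \<forall>n. ?P n (k n) \<and> ?Q n (k n) (k (Suc n))"
  proof (rule dependent_nat_choice)
    show "\<exists>k. ?P 0 k" using leq_refl car by blast
  next
    fix k n assume "?P n k"
    have "\<forall>i. \<exists>l. i \<le> Suc n \<longrightarrow> a i (Suc n) \<preceq> a (Suc n) l" using ex by blast
    then obtain l where l: "\<And>i. i \<le> Suc n \<Longrightarrow> a i (Suc n) \<preceq> a (Suc n) (l i)" by metis
    obtain l' where l': "a n (Suc k) \<preceq> a (Suc n) l'" using ex[of n "Suc n"] by auto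
    define m where "m = Max (insert l' (l ` {..Suc n}))"
    have m: "l' \<le> m" "\<And>i. i \<le> Suc n \<Longrightarrow> l i \<le> m" unfolding m_def by (intro Max_ge; simp)+
    have "?P (Suc n) m"
      using l m(2) leq_trans[OF car car car] increasing_mono[OF inc] by blast
    moreover have "?Q n k m"
      using way_below_leq_trans[OF a(1) leq_trans[OF car car car l' increasing_mono[OF inc m(1)]] car] .
    ultimately show "\<exists>y. ?P (Suc n) y \<and> ?Q n k y" by blast
  qed
  then obtain k where k: "\<And>n. ?P n (k n)" "\<And>n. ?Q n (k n) (k (Suc n))" by blast
  have scar: "s \<in> carrier S" using x(2) by (rule seq_sup_carrier)
  have "seq_sup S (\<lambda>n. a n (k n)) s"
    unfolding seq_sup_def
  proof (intro conjI ballI allI impI)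
    show "a n (k n) \<preceq> s" for n
      using leq_trans[OF car xcar scar seq_sup_upper[OF a(2)] seq_sup_upper[OF x(2)]] .
  next
    fix u assume u: "u \<in> carrier S" "\<forall>n. a n (k n) \<preceq> u"
    have "a i n \<preceq> u" for i n
    proof -
      have "a i n \<preceq> a i (max i n)" by (rule increasing_mono[OF inc]) simp
      moreover have "a i (max i n) \<preceq> a (max i n) (k (max i n))" using k(1) by simp
      ultimately show ?thesis using leq_trans[OF car car u(1)] leq_trans[OF car car car] u(2) by blast
    qed
    then have "x i \<preceq> u" for i using seq_sup_least[OF a(2) u(1)] by blast
    then show "s \<preceq> u" using seq_sup_least[OF x(2) u(1)] by blast
  qed (rule scar)
  with k(2) show ?thesis by blast
qed

end

lemma seq_closureI:
  "\<lbrakk>range x \<subseteq> M; increasing S x; seq_sup S x s\<rbrakk> \<Longrightarrow> s \<in> seq_closure S M"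
  unfolding seq_closure_def by blast

lemma cu_way_below_increasing:
  assumes "cu_semigroup S" "\<forall>n. x n \<lless>\<^bsub>S\<^esub> x (Suc n)"
  shows "increasing S x"
  using positively_ordered_monoid.way_below_increasing[OF cu_semigroup.axioms(1)[OF assms(1)]]
    assms(2) by simp

text \<open>Sub-Cu-semigroups obtained by closing a suitable submonoid under suprema.\<close>

locale cu_generating = cu_semigroup +
  fixes M
  assumes submonoid_M: "submonoid M S"
    and approx_M: "x \<in> M \<Longrightarrow> \<exists>a. range a \<subseteq> M \<and> (\<forall>n. a n \<lless> a (Suc n)) \<and> seq_sup S a x"
begin

abbreviation "H \<equiv> seq_closure S M"

lemma M_subset: "M \<subseteq> carrier S"
  using submonoid_M by (rule submonoid.subset)

lemma M_subset_H: "M \<subseteq> H"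
proof
  fix s assume s: "s \<in> M"
  then have "s \<in> carrier S" using M_subset by blast
  then have const: "increasing S (\<lambda>_. s)" "seq_sup S (\<lambda>_. s) s" using seq_sup_const by blast+
  have "range (\<lambda>_::nat. s) \<subseteq> M" using s by (simp add: image_subset_iff)
  then show "s \<in> H" using const by (rule seq_closureI)
qed

lemma H_subset: "H \<subseteq> carrier S"
  by (auto simp: seq_closure_def seq_sup_def)

lemma approx_limit:
  assumes x: "increasing S x" "seq_sup S x s"
    and ap: "\<And>i. \<exists>a. range a \<subseteq> M \<and> (\<forall>n. a n \<lless> a (Suc n)) \<and> seq_sup S a (x i)"
  shows "\<exists>a. range a \<subseteq> M \<and> (\<forall>n. a n \<lless> a (Suc n)) \<and> seq_sup S a s"
proof -
  obtain a where a: "\<And>i. range (a i) \<subseteq> M" "\<And>i k. a i k \<lless> a i (Suc k)" "\<And>i. seq_sup S (a i) (x i)"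
    using ap by metis
  obtain k where "\<forall>n. a n (k n) \<lless> a (Suc n) (k (Suc n))" "seq_sup S (\<lambda>n. a n (k n)) s"
    using diagonal_sequence[OF x a(2,3)] by blast
  then show ?thesis using a(1) by (intro exI[of _ "\<lambda>n. a n (k n)"]) blast
qed

lemma approx_H: "s \<in> H \<Longrightarrow> \<exists>a. range a \<subseteq> M \<and> (\<forall>n. a n \<lless> a (Suc n)) \<and> seq_sup S a s"
proof -
  assume "s \<in> H"
  then obtain x where x: "range x \<subseteq> M" "increasing S x" "seq_sup S x s"
    unfolding seq_closure_def by blast
  show ?thesis using x(1) by (intro approx_limit[OF x(2,3)] approx_M) blast
qed

lemma H_sup_closed:
  assumes "increasing S x" "seq_sup S x s" "range x \<subseteq> H"
  shows "s \<in> H"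
proof -
  obtain a where a: "range a \<subseteq> M" "\<forall>n. a n \<lless> a (Suc n)" "seq_sup S a s"
    using approx_limit[OF assms(1,2) approx_H] assms(3) by blast
  have "increasing S a" using a(2) by (intro way_below_increasing) blast
  with a show ?thesis unfolding seq_closure_def by blast
qed

lemma submonoid_H: "submonoid H S"
proof
  show "H \<subseteq> carrier S" by (rule H_subset)
  show "\<one> \<in> H" using M_subset_H submonoid.one_closed[OF submonoid_M] by blast
next
  fix s t assume "s \<in> H" "t \<in> H"
  then obtain x y where x: "range x \<subseteq> M" "increasing S x" "seq_sup S x s"
    and y: "range y \<subseteq> M" "increasing S y" "seq_sup S y t"
    unfolding seq_closure_def by blast
  have "range (\<lambda>n. x n \<otimes> y n) \<subseteq> M"
    using x(1) y(1) submonoid.m_closed[OF submonoid_M] by blast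
  then show "s \<otimes> t \<in> H"
    using increasing_add[OF x(2) y(2)] O4[OF x(2) y(2) x(3) y(3)] by (rule seq_closureI)
qed

abbreviation "SH \<equiv> S\<lparr>carrier := H\<rparr>"

lemma increasing_SH: "increasing SH x \<longleftrightarrow> increasing S x \<and> range x \<subseteq> H"
  unfolding increasing_def using H_subset by auto

lemma seq_sup_SH:
  assumes "increasing SH x"
  shows "seq_sup SH x s \<longleftrightarrow> seq_sup S x s"
proof -
  have x: "increasing S x" "range x \<subseteq> H" using assms increasing_SH by auto
  obtain t where t: "seq_sup S x t" using O1[OF x(1)] by blast
  have tH: "t \<in> H" using H_sup_closed[OF x(1) t x(2)] .
  have down: "seq_sup SH x r" if "seq_sup S x r" "r \<in> H" for r
    using that H_subset unfolding seq_sup_def by auto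
  show ?thesis
  proof
    assume s: "seq_sup SH x s"
    then have "s \<preceq> t" "t \<preceq> s" "s \<in> H"
      using down[OF t tH] unfolding seq_sup_def by auto
    then have "s = t" using leq_antisym H_subset tH by blast
    then show "seq_sup S x s" using t by simp
  next
    assume "seq_sup S x s"
    then show "seq_sup SH x s" using H_sup_closed[OF x(1) _ x(2)] down by blast
  qed
qed

lemma way_below_SH: "x \<lless>\<^bsub>SH\<^esub> y \<longleftrightarrow> x \<in> H \<and> y \<in> H \<and> x \<lless> y"
proof
  assume xy: "x \<lless>\<^bsub>SH\<^esub> y"
  then have H: "x \<in> H" "y \<in> H" by (simp_all add: way_below_def)
  obtain a where a: "range a \<subseteq> M" "\<forall>n. a n \<lless> a (Suc n)" "seq_sup S a y"
    using approx_H H(2) by blast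
  have inc: "increasing SH a"
    using way_below_increasing[of a] a(1,2) M_subset_H increasing_SH by blast
  obtain n where "x \<preceq> a n"
    using way_belowD[OF xy inc, of y] seq_sup_SH[OF inc] a(3) leq_refl H(2) H_subset by auto
  moreover have "a n \<lless> y" using way_below_sup a(2,3) by blast
  ultimately show "x \<in> H \<and> y \<in> H \<and> x \<lless> y"
    using leq_way_below_trans H H_subset by blast
next
  assume xy: "x \<in> H \<and> y \<in> H \<and> x \<lless> y"
  have "\<exists>n. x \<preceq> z n" if "increasing SH z" "seq_sup SH z s" "y \<preceq> s" for z s
    using way_belowD[of S x y z s] xy that increasing_SH seq_sup_SH by blast
  then show "x \<lless>\<^bsub>SH\<^esub> y" unfolding way_below_def[of SH] using xy by auto
qed

lemma cu_semigroup_SH: "cu_semigroup SH"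
proof -
  interpret sub: submonoid H S by (rule submonoid_H)
  have "comm_monoid SH"
    by (rule comm_monoid.submonoid_is_comm_monoid[OF comm_monoid_axioms submonoid_H])
  moreover have "positively_ordered_monoid_axioms SH"
  proof
    note car = subsetD[OF H_subset]
    show "x \<preceq>\<^bsub>SH\<^esub> x" if "x \<in> carrier SH" for x
      using that leq_refl car by simp
    show "x = y" if "x \<in> carrier SH" "y \<in> carrier SH" "x \<preceq>\<^bsub>SH\<^esub> y" "y \<preceq>\<^bsub>SH\<^esub> x" for x y
      using that leq_antisym[of x y] car by simp
    show "x \<preceq>\<^bsub>SH\<^esub> z" if "x \<in> carrier SH" "y \<in> carrier SH" "z \<in> carrier SH"
      "x \<preceq>\<^bsub>SH\<^esub> y" "y \<preceq>\<^bsub>SH\<^esub> z" for x y z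
      using that leq_trans[of x y z] car by simp
    show "x \<otimes>\<^bsub>SH\<^esub> z \<preceq>\<^bsub>SH\<^esub> y \<otimes>\<^bsub>SH\<^esub> z" if "x \<in> carrier SH" "y \<in> carrier SH" "z \<in> carrier SH"
      "x \<preceq>\<^bsub>SH\<^esub> y" for x y z
      using that leq_add[of x y z] car by simp
    show "\<one>\<^bsub>SH\<^esub> \<preceq>\<^bsub>SH\<^esub> x" if "x \<in> carrier SH" for x
      using that zero_leq car by simp
  qed
  moreover have "cu_semigroup_axioms SH"
  proof
    show "\<exists>s. seq_sup SH x s" if "increasing SH x" for x
      using O1 seq_sup_SH[OF that] that increasing_SH by blast
    show "\<exists>x. (\<forall>n. x n \<lless>\<^bsub>SH\<^esub> x (Suc n)) \<and> seq_sup SH x s" if "s \<in> carrier SH" for s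
    proof -
      have "s \<in> H" using that by simp
      then obtain a where a: "range a \<subseteq> M" "\<forall>n. a n \<lless> a (Suc n)" "seq_sup S a s"
        using approx_H by blast
      have "range a \<subseteq> H" using a(1) M_subset_H by blast
      moreover have "increasing SH a"
        using cu_way_below_increasing[OF cu_semigroup_axioms a(2)] \<open>range a \<subseteq> H\<close> increasing_SH by simp
      moreover have "\<forall>n. a n \<lless>\<^bsub>SH\<^esub> a (Suc n)"
        using a(2) \<open>range a \<subseteq> H\<close> way_below_SH by auto
      ultimately show ?thesis using a(3) seq_sup_SH by blast
    qed
    show "a' \<otimes>\<^bsub>SH\<^esub> b' \<lless>\<^bsub>SH\<^esub> a \<otimes>\<^bsub>SH\<^esub> b" if "a' \<lless>\<^bsub>SH\<^esub> a" "b' \<lless>\<^bsub>SH\<^esub> b" for a a' b b'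
      using that O3 way_below_SH by simp
    show "seq_sup SH (\<lambda>n. x n \<otimes>\<^bsub>SH\<^esub> y n) (s \<otimes>\<^bsub>SH\<^esub> t)"
      if "increasing SH x" "increasing SH y" "seq_sup SH x s" "seq_sup SH y t" for x y s t
    proof -
      have "increasing SH (\<lambda>n. x n \<otimes> y n)"
        using that(1,2) increasing_add sub.m_closed by (simp add: increasing_SH image_subset_iff)
      then show ?thesis using that O4 by (simp add: seq_sup_SH increasing_SH)
    qed
  qed
  ultimately show ?thesis
    by (simp add: cu_semigroup_def positively_ordered_monoid_def)
qed

lemma sub_cu_semigroup_H: "sub_cu_semigroup H S"
proof -
  have "cu_morphism SH S (\<lambda>x. x)"
    using H_subset way_below_SH seq_sup_SH by (intro cu_morphismI) auto
  then show ?thesis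
    using submonoid_H cu_semigroup_SH by (simp add: sub_cu_semigroup_def)
qed

end

lemma sub_cu_subset: "sub_cu_semigroup T S \<Longrightarrow> T \<subseteq> carrier S"
  by (simp add: sub_cu_semigroup_def submonoid.subset)

lemma sub_cu_incl: "sub_cu_semigroup T S \<Longrightarrow> cu_morphism (S\<lparr>carrier := T\<rparr>) S (\<lambda>x. x)"
  by (simp add: sub_cu_semigroup_def)

lemma sub_cu_increasing: 
  "sub_cu_semigroup T S \<Longrightarrow> increasing (S\<lparr>carrier := T\<rparr>) x \<longleftrightarrow> increasing S x \<and> range x \<subseteq> T"
  using sub_cu_subset unfolding increasing_def by fastforce

lemma sub_cu_sup:
  assumes "cu_semigroup S" and T: "sub_cu_semigroup T S"
    and x: "increasing S x" "range x \<subseteq> T" "seq_sup S x s"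
  shows "s \<in> T"
proof -
  interpret cu_semigroup S by fact
  have x': "increasing (S\<lparr>carrier := T\<rparr>) x" using sub_cu_increasing[OF T] x by blast
  obtain t where t: "seq_sup (S\<lparr>carrier := T\<rparr>) x t"
    using cu_semigroup.O1[OF _ x'] T unfolding sub_cu_semigroup_def by blast
  have "t = s" using cu_morphismD(4)[OF sub_cu_incl[OF T] x' t] seq_sup_unique x(3) by blast
  then show ?thesis using seq_sup_carrier[OF t] by simp
qed

lemma seq_closure_sub_cu:
  assumes "cu_semigroup S" "sub_cu_semigroup T S" "M \<subseteq> T"
  shows "seq_closure S M \<subseteq> T"
  unfolding seq_closure_def using sub_cu_sup[OF assms(1,2)] assms(3) by blast

lemma cu_morphism_corestrict:
  assumes f: "cu_morphism R S f" and H: "sub_cu_semigroup H S"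
    and img: "\<And>x. x \<in> carrier R \<Longrightarrow> f x \<in> H"
  shows "cu_morphism R (S\<lparr>carrier := H\<rparr>) f"
proof (rule cu_morphismI)
  have sub: "H \<subseteq> carrier S" by (rule sub_cu_subset[OF H])
  show "seq_sup (S\<lparr>carrier := H\<rparr>) (\<lambda>n. f (x n)) (f s)" if "increasing R x" "seq_sup R x s" for x s
    using cu_morphismD(4)[OF f that] img[OF seq_sup_carrier[OF that(2)]] sub
    unfolding seq_sup_def by auto
  show "f x \<lless>\<^bsub>S\<lparr>carrier := H\<rparr>\<^esub> f y" if xy: "x \<lless>\<^bsub>R\<^esub> y" for x y
  proof -
    have "\<exists>n. f x \<preceq>\<^bsub>S\<^esub> z n"
      if z: "increasing (S\<lparr>carrier := H\<rparr>) z" "seq_sup (S\<lparr>carrier := H\<rparr>) z s" "f y \<preceq>\<^bsub>S\<^esub> s" for z s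
      using way_belowD[OF cu_morphismD(5)[OF f xy]] cu_morphismD(4)[OF sub_cu_incl[OF H] z(1,2)]
        z sub_cu_increasing[OF H] by blast
    then show ?thesis
      unfolding way_below_def using img way_below_carrier[OF xy] by auto
  qed
qed (simp_all add: cu_morphismD[OF f] img)


subsection \<open>Suprema in \<open>Sep\<close>\<close>

lemma directed_submonoid:
  assumes D: "directed_family D" and sub: "\<And>T. T \<in> D \<Longrightarrow> submonoid T S"
  shows "submonoid (\<Union>D) S"
proof
  show "\<Union>D \<subseteq> carrier S" using sub submonoid.subset by blast
  show "\<one>\<^bsub>S\<^esub> \<in> \<Union>D"
    using D sub submonoid.one_closed unfolding directed_family_def by blast
next
  fix x y assume "x \<in> \<Union>D" "y \<in> \<Union>D"
  then obtain A B where "A \<in> D" "x \<in> A" "B \<in> D" "y \<in> B" by blast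
  then obtain C where "C \<in> D" "x \<in> C" "y \<in> C"
    using D unfolding directed_family_def by blast
  then show "x \<otimes>\<^bsub>S\<^esub> y \<in> \<Union>D" using submonoid.m_closed[OF sub] by blast
qed

lemma Sep_generating:
  assumes S: "cu_semigroup S" and D: "D \<subseteq> Sep S" "directed_family D"
  shows "cu_generating S (\<Union>D)"
proof -
  have sub: "sub_cu_semigroup T S" if "T \<in> D" for T using D(1) that unfolding Sep_def by blast
  have "submonoid (\<Union>D) S"
    using directed_submonoid[OF D(2)] sub unfolding sub_cu_semigroup_def by blast
  moreover have "\<exists>a. range a \<subseteq> \<Union>D \<and> (\<forall>n. a n \<lless>\<^bsub>S\<^esub> a (Suc n)) \<and> seq_sup S a x" if "x \<in> \<Union>D" for x
  proof -
    obtain T where T: "T \<in> D" "x \<in> T" using \<open>x \<in> \<Union>D\<close> by blast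
    let ?T = "S\<lparr>carrier := T\<rparr>"
    have cuT: "cu_semigroup ?T" using sub[OF T(1)] unfolding sub_cu_semigroup_def by blast
    then obtain a where a: "\<forall>n. a n \<lless>\<^bsub>?T\<^esub> a (Suc n)" "seq_sup ?T a x"
      using cu_semigroup.O2[OF cuT, of x] T(2) by auto
    have inc: "increasing ?T a"
      using cu_way_below_increasing[OF cuT a(1)] .
    note incl = sub_cu_incl[OF sub[OF T(1)]]
    have "range a \<subseteq> T" using inc sub_cu_increasing[OF sub[OF T(1)]] by simp
    then have "range a \<subseteq> \<Union>D" using T(1) by blast
    moreover have "\<forall>n. a n \<lless>\<^bsub>S\<^esub> a (Suc n)"
      using cu_morphismD(5)[OF incl] a(1) by simp
    ultimately show ?thesis using cu_morphismD(4)[OF incl inc a(2)] by blast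
  qed
  ultimately show ?thesis
    using S by (simp add: cu_generating_def cu_generating_axioms_def)
qed

lemma Sep_sup_in_Sep:
  assumes S: "cu_semigroup S" and D: "D \<subseteq> Sep S" "countable D" "directed_family D"
  shows "Sep_sup S D \<in> Sep S"
proof -
  interpret cu_generating S "\<Union>D" by (rule Sep_generating[OF S D(1,3)])
  have "\<forall>T\<in>D. \<exists>B\<subseteq>T. countable B \<and>
      (\<forall>s\<in>T. \<exists>x. range x \<subseteq> B \<and> increasing (S\<lparr>carrier := T\<rparr>) x \<and> seq_sup (S\<lparr>carrier := T\<rparr>) x s)"
    using D(1) unfolding Sep_def cu_separable_def by auto
  then obtain B where B: "\<And>T. T \<in> D \<Longrightarrow> B T \<subseteq> T \<and> countable (B T)"
    "\<And>T s. \<lbrakk>T \<in> D; s \<in> T\<rbrakk> \<Longrightarrow>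
       \<exists>x. range x \<subseteq> B T \<and> increasing (S\<lparr>carrier := T\<rparr>) x \<and> seq_sup (S\<lparr>carrier := T\<rparr>) x s"
    by metis
  define C where "C = (\<Union>T\<in>D. B T)"
  have C: "C \<subseteq> \<Union>D" "countable C" unfolding C_def using B(1) D(2) by auto
  have basis: "\<exists>x. range x \<subseteq> C \<and> increasing S x \<and> seq_sup S x s" if sD: "s \<in> \<Union>D" for s
  proof -
    obtain T where T: "T \<in> D" "s \<in> T" using sD by blast
    obtain x where x: "range x \<subseteq> B T" "increasing (S\<lparr>carrier := T\<rparr>) x" "seq_sup (S\<lparr>carrier := T\<rparr>) x s"
      using B(2)[OF T] by blast
    have sub: "sub_cu_semigroup T S" using D(1) T(1) unfolding Sep_def by blast
    show ?thesis
      using cu_morphismD(4)[OF sub_cu_incl[OF sub] x(2,3)] x(1,2) T(1) sub_cu_increasing[OF sub]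
      unfolding C_def by blast
  qed
  have "\<exists>x. range x \<subseteq> C \<and> increasing SH x \<and> seq_sup SH x s" if sH: "s \<in> H" for s
  proof -
    obtain a where a: "range a \<subseteq> \<Union>D" "\<forall>n. a n \<lless>\<^bsub>S\<^esub> a (Suc n)" "seq_sup S a s"
      using approx_H[OF sH] by blast
    have acar: "a n \<in> carrier S" for n using a(1) M_subset by blast
    have "\<exists>c\<in>C. a n \<preceq>\<^bsub>S\<^esub> c \<and> c \<preceq>\<^bsub>S\<^esub> a (Suc n)" for n
    proof -
      obtain x where x: "range x \<subseteq> C" "increasing S x" "seq_sup S x (a (Suc n))"
        using basis[of "a (Suc n)"] a(1) by blast
      obtain m where "a n \<preceq>\<^bsub>S\<^esub> x m"
        using way_belowD[OF a(2)[rule_format] x(2,3) leq_refl[OF acar]] by blast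
      then show ?thesis using x(1) seq_sup_upper[OF x(3)] by blast
    qed
    then obtain c where c: "\<And>n. c n \<in> C" "\<And>n. a n \<preceq>\<^bsub>S\<^esub> c n" "\<And>n. c n \<preceq>\<^bsub>S\<^esub> a (Suc n)" by metis
    have ccar: "c n \<in> carrier S" for n using c(1) C(1) M_subset by blast
    have inc: "increasing S c"
      unfolding increasing_def using ccar leq_trans[OF ccar acar ccar] c(2,3) by blast
    then have incH: "increasing SH c"
      using c(1) C(1) M_subset_H increasing_SH by blast
    have scar: "s \<in> carrier S" using seq_sup_carrier[OF a(3)] .
    have "seq_sup S c s"
      unfolding seq_sup_def
      using scar leq_trans[OF ccar acar scar c(3) seq_sup_upper[OF a(3)]]
        seq_sup_least[OF a(3)] leq_trans[OF acar ccar _ c(2)] by blast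
    then show ?thesis using incH seq_sup_SH c(1) by blast
  qed
  then have "cu_separable SH"
    unfolding cu_separable_def using C M_subset_H by (intro exI[of _ C]) auto
  then show ?thesis
    using sub_cu_semigroup_H by (simp add: Sep_def Sep_sup_def)
qed

lemma Sep_sup_upper:
  assumes "cu_semigroup S" "D \<subseteq> Sep S" "directed_family D" "T \<in> D"
  shows "T \<subseteq> Sep_sup S D"
  using cu_generating.M_subset_H[OF Sep_generating[OF assms(1-3)]] assms(4)
  unfolding Sep_sup_def by blast

lemma Sep_sup_least:
  assumes "cu_semigroup S" "U \<in> Sep S" "\<And>T. T \<in> D \<Longrightarrow> T \<subseteq> U"
  shows "Sep_sup S D \<subseteq> U"
  unfolding Sep_sup_def using assms by (intro seq_closure_sub_cu) (auto simp: Sep_def)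


subsection \<open>The universal property on arbitrary types\<close>

lemma cu_transport:
  fixes T :: "'c po_monoid" and e :: "'c \<Rightarrow> 'd"
  assumes T: "cu_semigroup T" and inj: "inj_on e (carrier T)"
  shows "\<exists>T' :: 'd po_monoid. \<exists>d. cu_semigroup T' \<and> cu_morphism T T' e \<and> cu_morphism T' T d \<and>
           (\<forall>t\<in>carrier T. d (e t) = t)"
proof -
  interpret cu_semigroup T by fact
  define d where "d = inv_into (carrier T) e"
  define T' :: "'d po_monoid" where
    "T' = \<lparr>carrier = e ` carrier T, mult = (\<lambda>a b. e (d a \<otimes>\<^bsub>T\<^esub> d b)), one = e \<one>\<^bsub>T\<^esub>,
           leq = (\<lambda>a b. d a \<preceq>\<^bsub>T\<^esub> d b)\<rparr>"
  have de [simp]: "d (e t) = t" if "t \<in> carrier T" for t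
    unfolding d_def using inj that by (rule inv_into_f_f)
  have sel [simp]: "carrier T' = e ` carrier T" "\<one>\<^bsub>T'\<^esub> = e \<one>\<^bsub>T\<^esub>"
      "a \<otimes>\<^bsub>T'\<^esub> b = e (d a \<otimes>\<^bsub>T\<^esub> d b)" "a \<preceq>\<^bsub>T'\<^esub> b \<longleftrightarrow> d a \<preceq>\<^bsub>T\<^esub> d b" for a b
    by (simp_all add: T'_def)
  have dcar [simp]: "d a \<in> carrier T" and ed [simp]: "e (d a) = a" if "a \<in> e ` carrier T" for a
    using that by auto
  have incd: "increasing T' x \<Longrightarrow> increasing T (\<lambda>n. d (x n))" for x
    unfolding increasing_def by auto
  have supd: "increasing T' x \<Longrightarrow> seq_sup T' x s \<longleftrightarrow> s \<in> carrier T' \<and> seq_sup T (\<lambda>n. d (x n)) (d s)" for x s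
    unfolding seq_sup_def by auto
  have ince: "increasing T' (\<lambda>n. e (x n))" if "increasing T x" for x
    using that unfolding increasing_def by auto
  have supe: "seq_sup T' (\<lambda>n. e (x n)) (e s)" if "increasing T x" "seq_sup T x s" for x s
    using supd[OF ince[OF that(1)]] increasing_carrier[OF that(1)] seq_sup_carrier[OF that(2)] that(2)
    by simp
  have wbd: "d x \<lless>\<^bsub>T\<^esub> d y" if "x \<lless>\<^bsub>T'\<^esub> y" for x y
    unfolding way_below_def[of T]
  proof (intro conjI allI impI)
    show "d x \<in> carrier T" "d y \<in> carrier T" using way_below_carrier[OF that] by auto
    fix z s assume z: "increasing T z \<and> seq_sup T z s \<and> d y \<preceq>\<^bsub>T\<^esub> s"
    then have "\<exists>n. x \<preceq>\<^bsub>T'\<^esub> e (z n)"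
      using way_belowD[OF that ince supe, of z s] seq_sup_carrier[of T z s] by simp
    then show "\<exists>n. d x \<preceq>\<^bsub>T\<^esub> z n" using z increasing_carrier[of T z] by simp
  qed
  have wbe: "e x \<lless>\<^bsub>T'\<^esub> e y" if "x \<lless>\<^bsub>T\<^esub> y" for x y
    unfolding way_below_def[of T']
  proof (intro conjI allI impI)
    note car = way_below_carrier[OF that]
    show "e x \<in> carrier T'" "e y \<in> carrier T'" using car by auto
    fix z s assume z: "increasing T' z \<and> seq_sup T' z s \<and> e y \<preceq>\<^bsub>T'\<^esub> s"
    then show "\<exists>n. e x \<preceq>\<^bsub>T'\<^esub> z n"
      using way_belowD[OF that incd, of z "d s"] supd[of z s] car by simp
  qed
  have "comm_monoid T'"
    by (rule comm_monoidI) (auto simp: m_ac)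
  moreover have "positively_ordered_monoid_axioms T'"
  proof
    show "x = y" if "x \<in> carrier T'" "y \<in> carrier T'" "x \<preceq>\<^bsub>T'\<^esub> y" "y \<preceq>\<^bsub>T'\<^esub> x" for x y
      using that leq_antisym[of "d x" "d y"] by (metis dcar ed sel(1) sel(4))
    show "x \<preceq>\<^bsub>T'\<^esub> z" if "x \<in> carrier T'" "y \<in> carrier T'" "z \<in> carrier T'"
      "x \<preceq>\<^bsub>T'\<^esub> y" "y \<preceq>\<^bsub>T'\<^esub> z" for x y z
      using that leq_trans[of "d x" "d y" "d z"] by simp
  qed (auto intro: leq_refl leq_add zero_leq)
  moreover have "cu_semigroup_axioms T'"
  proof
    show "\<exists>s. seq_sup T' x s" if x: "increasing T' x" for x
    proof -
      obtain s where s: "seq_sup T (\<lambda>n. d (x n)) s" using O1[OF incd[OF x]] by blast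
      then have "seq_sup T' x (e s)" using supd[OF x] seq_sup_carrier[OF s] by simp
      then show ?thesis ..
    qed
    show "\<exists>x. (\<forall>n. x n \<lless>\<^bsub>T'\<^esub> x (Suc n)) \<and> seq_sup T' x s" if s: "s \<in> carrier T'" for s
    proof -
      obtain x where x: "\<forall>n. x n \<lless>\<^bsub>T\<^esub> x (Suc n)" "seq_sup T x (d s)"
        using O2[of "d s"] s by auto
      have "increasing T x" using cu_way_below_increasing[OF T x(1)] .
      then have "seq_sup T' (\<lambda>n. e (x n)) s" using supe[OF _ x(2)] s by simp
      moreover have "\<forall>n. e (x n) \<lless>\<^bsub>T'\<^esub> e (x (Suc n))" using x(1) wbe by simp
      ultimately show ?thesis by (intro exI[of _ "\<lambda>n. e (x n)"] conjI)
    qed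
    show "a' \<otimes>\<^bsub>T'\<^esub> b' \<lless>\<^bsub>T'\<^esub> a \<otimes>\<^bsub>T'\<^esub> b" if "a' \<lless>\<^bsub>T'\<^esub> a" "b' \<lless>\<^bsub>T'\<^esub> b" for a a' b b'
      using wbe[OF O3[OF wbd[OF that(1)] wbd[OF that(2)]]] by simp
    show "seq_sup T' (\<lambda>n. x n \<otimes>\<^bsub>T'\<^esub> y n) (s \<otimes>\<^bsub>T'\<^esub> t)"
      if "increasing T' x" "increasing T' y" "seq_sup T' x s" "seq_sup T' y t" for x y s t
    proof -
      have "seq_sup T (\<lambda>n. d (x n) \<otimes>\<^bsub>T\<^esub> d (y n)) (d s \<otimes>\<^bsub>T\<^esub> d t)"
        using O4[OF incd incd] that supd by simp
      then show ?thesis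
        using supe[OF increasing_add[OF incd[OF that(1)] incd[OF that(2)]]] by simp
    qed
  qed
  ultimately have "cu_semigroup T'"
    by (simp add: cu_semigroup_def positively_ordered_monoid_def)
  moreover have "cu_morphism T T' e"
    using wbe supe by (intro cu_morphismI) auto
  moreover have "cu_morphism T' T d"
    using wbd supd by (intro cu_morphismI) auto
  ultimately show ?thesis using de by (intro exI[of _ T'] exI[of _ d] conjI ballI)
qed

definition cocone_image :: "'i set \<Rightarrow> ('i \<Rightarrow> 'a po_monoid) \<Rightarrow> ('i \<Rightarrow> 'a \<Rightarrow> 'b) \<Rightarrow> 'b set" where
  "cocone_image I S g = (\<Union>i\<in>I. g i ` carrier (S i))"

lemma cocone_generating:
  assumes sys: "inductive_system I r S \<phi>" and T: "cu_semigroup T" and g: "cocone I r S \<phi> T g"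
  shows "cu_generating T (cocone_image I S g)"
proof -
  interpret cu_semigroup T by fact
  have dir: "directed_index I r" and S: "\<And>i. i \<in> I \<Longrightarrow> cu_semigroup (S i)"
    and \<phi>: "\<And>i j. \<lbrakk>i \<in> I; j \<in> I; r i j\<rbrakk> \<Longrightarrow> cu_morphism (S i) (S j) (\<phi> i j)"
    using sys unfolding inductive_system_def by auto
  have gm: "\<And>i. i \<in> I \<Longrightarrow> cu_morphism (S i) T (g i)"
    and gc: "\<And>i j x. \<lbrakk>i \<in> I; j \<in> I; r i j; x \<in> carrier (S i)\<rbrakk> \<Longrightarrow> g j (\<phi> i j x) = g i x"
    using g unfolding cocone_def by auto
  have mon: "monoid (S i)" if "i \<in> I" for i
    using S[OF that] cu_semigroup.axioms(1) positively_ordered_monoid.axioms(1) comm_monoid.axioms(1)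
    by blast
  have "submonoid (cocone_image I S g) T"
  proof
    show "cocone_image I S g \<subseteq> carrier T"
      unfolding cocone_image_def using cu_morphismD(6)[OF gm] by blast
    obtain i where i: "i \<in> I" using dir unfolding directed_index_def by blast
    show "\<one>\<^bsub>T\<^esub> \<in> cocone_image I S g"
      unfolding cocone_image_def
      using i cu_morphismD(2)[OF gm[OF i]] monoid.one_closed[OF mon[OF i]] by force
  next
    fix x y assume "x \<in> cocone_image I S g" "y \<in> cocone_image I S g"
    then obtain i a j b where ij: "i \<in> I" "a \<in> carrier (S i)" "x = g i a"
        "j \<in> I" "b \<in> carrier (S j)" "y = g j b"
      unfolding cocone_image_def by blast
    obtain k where k: "k \<in> I" "r i k" "r j k"
      using dir ij unfolding directed_index_def by blast
    let ?a = "\<phi> i k a" and ?b = "\<phi> j k b"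
    have car: "?a \<in> carrier (S k)" "?b \<in> carrier (S k)"
      using cu_morphismD(6)[OF \<phi>] ij k by blast+
    have "x \<otimes>\<^bsub>T\<^esub> y = g k (?a \<otimes>\<^bsub>S k\<^esub> ?b)"
      using cu_morphismD(7)[OF gm[OF k(1)] car] gc ij k by simp
    then show "x \<otimes>\<^bsub>T\<^esub> y \<in> cocone_image I S g"
      unfolding cocone_image_def using k(1) monoid.m_closed[OF mon[OF k(1)] car] by blast
  qed
  moreover have "\<exists>a. range a \<subseteq> cocone_image I S g \<and> (\<forall>n. a n \<lless>\<^bsub>T\<^esub> a (Suc n)) \<and> seq_sup T a x"
    if xim: "x \<in> cocone_image I S g" for x
  proof -
    obtain i b where i: "i \<in> I" "b \<in> carrier (S i)" "x = g i b"
      using xim unfolding cocone_image_def by blast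
    obtain a where a: "\<forall>n. a n \<lless>\<^bsub>S i\<^esub> a (Suc n)" "seq_sup (S i) a b"
      using cu_semigroup.O2[OF S[OF i(1)] i(2)] by blast
    have inc: "increasing (S i) a"
      using cu_way_below_increasing[OF S[OF i(1)] a(1)] .
    have "range (\<lambda>n. g i (a n)) \<subseteq> cocone_image I S g"
      unfolding cocone_image_def using i(1) increasing_carrier[OF inc] by blast
    moreover have "\<forall>n. g i (a n) \<lless>\<^bsub>T\<^esub> g i (a (Suc n))"
      using cu_morphismD(5)[OF gm[OF i(1)]] a(1) by simp
    ultimately show ?thesis
      using cu_morphismD(4)[OF gm[OF i(1)] inc a(2)] i(3)
      by (intro exI[of _ "\<lambda>n. g i (a n)"]) simp
  qed
  ultimately show ?thesis
    using T by (simp add: cu_generating_def cu_generating_axioms_def)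
qed

lemma cocone_compose:
  assumes "cocone I r S \<phi> T g" "cu_morphism T U h"
  shows "cocone I r S \<phi> U (\<lambda>i x. h (g i x))"
  using assms cu_morphism_comp unfolding cocone_def by fastforce

lemma cocone_corestrict:
  assumes "cocone I r S \<phi> T g" "sub_cu_semigroup H T" "cocone_image I S g \<subseteq> H"
  shows "cocone I r S \<phi> (T\<lparr>carrier := H\<rparr>) g"
  using assms unfolding cocone_def cocone_image_def
  by (blast intro: cu_morphism_corestrict)

lemma cocone_carrier:
  "\<lbrakk>cocone I r S \<phi> T g; i \<in> I; x \<in> carrier (S i)\<rbrakk> \<Longrightarrow> g i x \<in> carrier T"
  unfolding cocone_def using cu_morphismD(6)[of "S i" T "g i" x] by simp

lemma factors_exists:
  "\<lbrakk>factors_uniquely I r S \<phi> L f T; cocone I r S \<phi> T g\<rbrakk> \<Longrightarrow>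
     \<exists>h. cu_morphism L T h \<and> (\<forall>i\<in>I. \<forall>x\<in>carrier (S i). h (f i x) = g i x)"
  unfolding factors_uniquely_def by blast

lemma Ex1_unique: "\<lbrakk>\<exists>!x. P x; P a; P b\<rbrakk> \<Longrightarrow> a = b"
  by blast

text \<open>An inductive limit is the sequential closure of the images of the members of the system.\<close>

lemma inductive_limit_generated:
  fixes L :: "'b po_monoid"
  assumes lim: "inductive_limit I r S \<phi> L f"
  shows "seq_closure L (cocone_image I S f) = carrier L"
proof -
  have sys: "inductive_system I r S \<phi>" and L: "cu_semigroup L" and f: "cocone I r S \<phi> L f"
    and univ: "\<And>T :: 'b po_monoid. cu_semigroup T \<Longrightarrow> factors_uniquely I r S \<phi> L f T"
    using lim unfolding inductive_limit_def by auto
  interpret cu_generating L "cocone_image I S f" by (rule cocone_generating[OF sys L f])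
  have pom: "positively_ordered_monoid L" by unfold_locales
  have fH: "cocone I r S \<phi> SH f"
    by (rule cocone_corestrict[OF f sub_cu_semigroup_H M_subset_H])
  obtain h where h: "cu_morphism L SH h" "\<forall>i\<in>I. \<forall>x\<in>carrier (S i). h (f i x) = f i x"
    using factors_exists[OF univ[OF cu_semigroup_SH] fH] by blast
  have fcar: "f i x \<in> carrier L" if "i \<in> I" "x \<in> carrier (S i)" for i x
    using M_subset that unfolding cocone_image_def by blast
  let ?h = "restrict h (carrier L)" and ?id = "restrict (\<lambda>x. x) (carrier L)"
  have "cu_morphism L L h"
    using cu_morphism_comp[OF h(1) sub_cu_incl[OF sub_cu_semigroup_H]] .
  then have hm: "cu_morphism L L ?h" using cu_morphism_cong[OF _ pom] by fastforce
  have "cu_morphism L L (\<lambda>x. x)" by (rule cu_morphismI) auto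
  then have idm: "cu_morphism L L ?id" using cu_morphism_cong[OF _ pom] by fastforce
  let ?P = "\<lambda>h. h \<in> extensional (carrier L) \<and> cu_morphism L L h \<and>
             (\<forall>i\<in>I. \<forall>x\<in>carrier (S i). h (f i x) = f i x)"
  have "\<exists>!h. ?P h"
    using univ[OF L] f unfolding factors_uniquely_def by blast
  moreover have "?P ?h" using hm h(2) fcar by simp
  moreover have "?P ?id" using idm fcar by simp
  ultimately have "?h = ?id" by (rule Ex1_unique[where P = ?P])
  then have "h x = x" if "x \<in> carrier L" for x using that by (metis restrict_apply')
  then have "x \<in> H" if "x \<in> carrier L" for x
    using cu_morphismD(6)[OF h(1) that] that by simp
  then show ?thesis using H_subset by blast
qed

lemma inductive_limit_universal:
  fixes L :: "'b po_monoid" and T :: "'c po_monoid" and S :: "'i \<Rightarrow> 'a po_monoid"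
  assumes lim: "inductive_limit I r S \<phi> L f" and T: "cu_semigroup T"
  shows "factors_uniquely I r S \<phi> L f T"
  unfolding factors_uniquely_def
proof (intro allI impI)
  fix g assume g: "cocone I r S \<phi> T g"
  have sys: "inductive_system I r S \<phi>" and L: "cu_semigroup L" and f: "cocone I r S \<phi> L f"
    and univ: "\<And>T :: (nat \<Rightarrow> 'i \<times> 'a) set po_monoid.
                 cu_semigroup T \<Longrightarrow> factors_uniquely I r S \<phi> L f T"
    using lim unfolding inductive_limit_def by auto
  have pomL: "positively_ordered_monoid L" and pomT: "positively_ordered_monoid T"
    using L T cu_semigroup.axioms(1) by auto
  interpret G: cu_generating T "cocone_image I S g" by (rule cocone_generating[OF sys T g])
  have gH: "cocone I r S \<phi> G.SH g"
    by (rule cocone_corestrict[OF g G.sub_cu_semigroup_H G.M_subset_H])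
  define e where "e = (\<lambda>t. {s :: nat \<Rightarrow> 'i \<times> 'a.
    (\<forall>n. fst (s n) \<in> I \<and> snd (s n) \<in> carrier (S (fst (s n)))) \<and>
    seq_sup T (\<lambda>n. g (fst (s n)) (snd (s n))) t})"
  have "inj_on e (carrier G.SH)"
  proof (rule inj_onI)
    fix t u assume t: "t \<in> carrier G.SH" and "u \<in> carrier G.SH" and eq: "e t = e u"
    obtain x where x: "range x \<subseteq> cocone_image I S g" "seq_sup T x t"
      using t unfolding seq_closure_def by auto
    have "\<forall>n. \<exists>p. fst p \<in> I \<and> snd p \<in> carrier (S (fst p)) \<and> x n = g (fst p) (snd p)"
      using x(1) unfolding cocone_image_def by fastforce
    then obtain s where s: "\<And>n. fst (s n) \<in> I \<and> snd (s n) \<in> carrier (S (fst (s n)))"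
      "\<And>n. x n = g (fst (s n)) (snd (s n))" by metis
    have "x = (\<lambda>n. g (fst (s n)) (snd (s n)))" using s(2) by blast
    then have "s \<in> e t" unfolding e_def using s(1) x(2) by simp
    then have "s \<in> e u" using eq by simp
    then show "t = u"
      using \<open>s \<in> e t\<close> G.seq_sup_unique unfolding e_def by blast
  qed
  then obtain T' :: "(nat \<Rightarrow> 'i \<times> 'a) set po_monoid" and d where T': "cu_semigroup T'"
      "cu_morphism G.SH T' e" "cu_morphism T' G.SH d" "\<forall>t\<in>carrier G.SH. d (e t) = t"
    using cu_transport[OF G.cu_semigroup_SH, where e = e] by blast
  have "cocone I r S \<phi> T' (\<lambda>i x. e (g i x))" by (rule cocone_compose[OF gH T'(2)])
  then obtain h where h: "cu_morphism L T' h" "\<forall>i\<in>I. \<forall>x\<in>carrier (S i). h (f i x) = e (g i x)"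
    using factors_exists[OF univ[OF T'(1)], of "\<lambda>i x. e (g i x)"] by blast
  have fcar: "f i x \<in> carrier L" if "i \<in> I" "x \<in> carrier (S i)" for i x
    using cocone_carrier[OF f that] .
  have gcar: "g i x \<in> carrier G.SH" if "i \<in> I" "x \<in> carrier (S i)" for i x
    using cocone_carrier[OF gH that] .
  let ?h = "restrict (\<lambda>x. d (h x)) (carrier L)"
  have "cu_morphism L T (\<lambda>x. d (h x))"
    using cu_morphism_comp[OF cu_morphism_comp[OF h(1) T'(3)] sub_cu_incl[OF G.sub_cu_semigroup_H]] .
  then have hm: "cu_morphism L T ?h" using cu_morphism_cong[OF _ pomL] by fastforce
  show "\<exists>!h. h \<in> extensional (carrier L) \<and> cu_morphism L T h \<and>
             (\<forall>i\<in>I. \<forall>x\<in>carrier (S i). h (f i x) = g i x)"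
  proof (rule ex1I[of _ ?h])
    show hq: "?h \<in> extensional (carrier L) \<and> cu_morphism L T ?h \<and>
          (\<forall>i\<in>I. \<forall>x\<in>carrier (S i). ?h (f i x) = g i x)"
      using hm h(2) T'(4) fcar gcar by simp
    fix k assume k: "k \<in> extensional (carrier L) \<and> cu_morphism L T k \<and>
          (\<forall>i\<in>I. \<forall>x\<in>carrier (S i). k (f i x) = g i x)"
    show "k = ?h"
    proof (rule extensionalityI[of _ "carrier L"])
      fix x assume "x \<in> carrier L"
      then obtain y where y: "range y \<subseteq> cocone_image I S f" "increasing L y" "seq_sup L y x"
        using inductive_limit_generated[OF lim] unfolding seq_closure_def by blast
      have "k (y n) = ?h (y n)" for n
      proof -
        obtain i a where ia: "i \<in> I" "a \<in> carrier (S i)" "y n = f i a"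
          using y(1) unfolding cocone_image_def by blast
        then show ?thesis using k hq by metis
      qed
      then have "(\<lambda>n. k (y n)) = (\<lambda>n. ?h (y n))" by blast
      then show "k x = ?h x"
        using cu_morphismD(4)[OF _ y(2,3), of T k] cu_morphismD(4)[OF hm y(2,3)] k
          G.seq_sup_unique by metis
    qed (use k in auto)
  qed
qed

end

theory Submission
  imports Defs
begin

text \<open>
  Almost divisibility only has to be tested on a generating submonoid. Let \<open>H\<close> consist of the
  suprema of increasing sequences in \<open>M\<close>, where every element of \<open>M\<close> is the supremum of a
  \<open>\<lless>\<close>-increasing sequence in \<open>M\<close>. If \<open>x' \<lless> x\<close> in \<open>H\<close>, then there are \<open>u \<lless> v\<close> in \<open>M\<close>
  with \<open>x' \<preceq> u\<close> and \<open>v \<preceq> x\<close>, and a witness of divisibility for \<open>u \<lless> v\<close> is one for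
  \<open>x' \<lless> x\<close>. This principle, \<open>almost_divisible_closure\<close>, is applied to three submonoids.

  For the Loewenheim-Skolem condition, the club consists of all separable sub-Cu-semigroups that
  are \<open>n\<close>-almost divisible. It is closed under suprema of countable directed families \<open>D\<close>, since
  \<open>Sep_sup S D\<close> is generated by \<open>\<Union>D\<close>, and two elements of \<open>\<Union>D\<close> lie in a common member of
  \<open>D\<close>, which contains a witness. It is cofinal, since a countable basis of a given separable
  sub-Cu-semigroup can be enlarged to a countable submonoid that contains \<open>\<lless>\<close>-approximating
  sequences of its elements and witnesses for its \<open>\<lless>\<close>-related pairs: this takes
  countably many operations, and a countable set closed under them exists.

  An inductive limit \<open>L\<close> is generated by the images of the members of the system. If
  \<open>x' \<lless> g b\<close> for the canonical map \<open>g\<close> of a member and an element \<open>b\<close> of it, then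
  \<open>x' \<preceq> g b'\<close> for some \<open>b' \<lless> b\<close>, and \<open>g\<close> carries a witness for \<open>b' \<lless> b\<close> to one for
  \<open>x' \<lless> g b\<close>.
\<close>

section \<open>Divisibility in generated semigroups\<close>

lemma nat_pow_carrier_update:
  "x [^]\<^bsub>S\<lparr>carrier := T\<rparr>\<^esub> (k::nat) = x [^]\<^bsub>S\<^esub> k"
  by (simp add: nat_pow_def)

context cu_generating
begin

lemma way_below_interpolate:
  assumes x: "x \<in> H" and wb: "x' \<lless> x"
  shows "\<exists>u\<in>M. \<exists>v\<in>M. x' \<preceq> u \<and> u \<lless> v \<and> v \<preceq> x"
proof -
  obtain a where a: "range a \<subseteq> M" "\<forall>n. a n \<lless> a (Suc n)" "seq_sup S a x"
    using approx_H[OF x] by blast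
  have inc: "increasing S a" using a(2) by (intro way_below_increasing) blast
  have "x \<in> carrier S" using x H_subset by blast
  then obtain m where "x' \<preceq> a m"
    using way_belowD[OF wb inc a(3)] leq_refl by blast
  moreover have "a (Suc m) \<preceq> x" using a(3) by (rule seq_sup_upper)
  ultimately show ?thesis using a(1,2) by blast
qed

lemma almost_divisible_closure:
  assumes div: "\<And>k u v. \<lbrakk>u \<in> M; v \<in> M; u \<lless> v\<rbrakk> \<Longrightarrow>
      \<exists>y\<in>H. y [^] (k::nat) \<preceq> v \<and> u \<preceq> y [^] ((k + 1) * (n + 1))"
  shows "almost_divisible n SH"
  unfolding almost_divisible_def nat_pow_carrier_update
proof (intro allI impI)
  fix k :: nat and x' x
  assume "x' \<lless>\<^bsub>SH\<^esub> x"
  then have x: "x' \<in> H" "x \<in> H" "x' \<lless> x" using way_below_SH by auto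
  obtain u v where uv: "u \<in> M" "v \<in> M" "x' \<preceq> u" "u \<lless> v" "v \<preceq> x"
    using way_below_interpolate[OF x(2,3)] by blast
  obtain y where y: "y \<in> H" "y [^] k \<preceq> v" "u \<preceq> y [^] ((k + 1) * (n + 1))"
    using div[OF uv(1,2,4)] by blast
  have car: "x' \<in> carrier S" "x \<in> carrier S" "u \<in> carrier S" "v \<in> carrier S" "y \<in> carrier S"
    using x(1,2) uv(1,2) y(1) H_subset M_subset by blast+
  have "y [^] k \<preceq> x"
    using leq_trans[OF nat_pow_closed[OF car(5)] car(4,2) y(2) uv(5)] .
  moreover have "x' \<preceq> y [^] ((k + 1) * (n + 1))"
    using leq_trans[OF car(1,3) nat_pow_closed[OF car(5)] uv(3) y(3)] .
  ultimately show "\<exists>y\<in>carrier SH. y [^] k \<preceq>\<^bsub>SH\<^esub> x \<and> x' \<preceq>\<^bsub>SH\<^esub> y [^] ((k + 1) * (n + 1))"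
    using y(1) by auto
qed

lemma countable_generating_in_Sep:
  assumes "countable M"
  shows "H \<in> Sep S"
proof -
  have "\<exists>x. range x \<subseteq> M \<and> increasing SH x \<and> seq_sup SH x s" if sH: "s \<in> H" for s
  proof -
    obtain x where x: "range x \<subseteq> M" "increasing S x" "seq_sup S x s"
      using sH unfolding seq_closure_def by blast
    then have "increasing SH x" using increasing_SH M_subset_H by blast
    then show ?thesis using x seq_sup_SH by blast
  qed
  then have "cu_separable SH"
    unfolding cu_separable_def using assms M_subset_H by (intro exI[of _ M]) auto
  then show ?thesis using sub_cu_semigroup_H by (simp add: Sep_def)
qed

end


section \<open>The club of almost divisible subsemigroups\<close>

lemma sub_cu_way_below:
  assumes T: "sub_cu_semigroup T S" and xy: "x \<in> T" "y \<in> T" "x \<lless>\<^bsub>S\<^esub> y"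
  shows "x \<lless>\<^bsub>S\<lparr>carrier := T\<rparr>\<^esub> y"
proof -
  have "\<exists>n. x \<preceq>\<^bsub>S\<^esub> z n"
    if z: "increasing (S\<lparr>carrier := T\<rparr>) z" "seq_sup (S\<lparr>carrier := T\<rparr>) z s" "y \<preceq>\<^bsub>S\<^esub> s" for z s
    using way_belowD[OF xy(3) _ cu_morphismD(4)[OF sub_cu_incl[OF T] z(1,2)] z(3)]
      sub_cu_increasing[OF T] z(1) by blast
  then show ?thesis unfolding way_below_def using xy(1,2) by auto
qed

lemma almost_divisible_Sep_sup:
  assumes S: "cu_semigroup S" and D: "D \<subseteq> Sep S" "directed_family D"
    and div: "\<And>T. T \<in> D \<Longrightarrow> almost_divisible n (S\<lparr>carrier := T\<rparr>)"
  shows "almost_divisible n (S\<lparr>carrier := Sep_sup S D\<rparr>)"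
proof -
  interpret cu_generating S "\<Union>D" by (rule Sep_generating[OF S D])
  show ?thesis
    unfolding Sep_sup_def
  proof (rule almost_divisible_closure)
    fix k :: nat and u v
    assume "u \<in> \<Union>D" "v \<in> \<Union>D" and wb: "u \<lless>\<^bsub>S\<^esub> v"
    then obtain T where T: "T \<in> D" "u \<in> T" "v \<in> T"
      using D(2) unfolding directed_family_def by blast
    then have "sub_cu_semigroup T S" using D(1) unfolding Sep_def by blast
    then have "u \<lless>\<^bsub>S\<lparr>carrier := T\<rparr>\<^esub> v" using T(2,3) wb by (rule sub_cu_way_below)
    then have "\<exists>y\<in>T. y [^]\<^bsub>S\<^esub> k \<preceq>\<^bsub>S\<^esub> v \<and> u \<preceq>\<^bsub>S\<^esub> y [^]\<^bsub>S\<^esub> ((k + 1) * (n + 1))"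
      using div[OF T(1)] unfolding almost_divisible_def nat_pow_carrier_update by simp
    moreover have "T \<subseteq> H" using T(1) M_subset_H by blast
    ultimately show "\<exists>y\<in>H. y [^]\<^bsub>S\<^esub> k \<preceq>\<^bsub>S\<^esub> v \<and> u \<preceq>\<^bsub>S\<^esub> y [^]\<^bsub>S\<^esub> ((k + 1) * (n + 1))" by blast
  qed
qed

text \<open>
  The downward Loewenheim-Skolem argument for binary operations with countably many values:
  the closure is reached after countably many steps.
\<close>

lemma countable_closed_superset:
  assumes A: "countable A" "A \<subseteq> U"
    and F: "\<And>x y. \<lbrakk>x \<in> U; y \<in> U\<rbrakk> \<Longrightarrow> countable (F x y) \<and> F x y \<subseteq> U"
  shows "\<exists>M. countable M \<and> A \<subseteq> M \<and> M \<subseteq> U \<and> (\<forall>x\<in>M. \<forall>y\<in>M. F x y \<subseteq> M)"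
proof -
  define G where "G X = X \<union> (\<Union>x\<in>X. \<Union>y\<in>X. F x y)" for X
  define N where "N i = (G ^^ i) A" for i
  have N_Suc: "N (Suc i) = G (N i)" for i by (simp add: N_def)
  have "mono N" unfolding mono_iff_le_Suc by (auto simp: N_Suc G_def)
  have N: "countable (N i) \<and> N i \<subseteq> U" for i
  proof (induction i)
    case 0
    show ?case using A by (simp add: N_def)
  next
    case (Suc i)
    then have "countable (F x y) \<and> F x y \<subseteq> U" if "x \<in> N i" "y \<in> N i" for x y
      using F that by blast
    then show ?case
      unfolding N_Suc G_def using Suc by (intro conjI countable_Un countable_UN) blast+
  qed
  have "F x y \<subseteq> (\<Union>i. N i)" if "x \<in> N i" "y \<in> N j" for x y i j
  proof -
    have "x \<in> N (max i j)" "y \<in> N (max i j)"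
      using that monoD[OF \<open>mono N\<close>] max.cobounded1 max.cobounded2 by blast+
    then have "F x y \<subseteq> N (Suc (max i j))" unfolding N_Suc G_def by blast
    then show ?thesis by blast
  qed
  moreover have "A \<subseteq> (\<Union>i. N i)" using UN_upper[of 0 UNIV N] by (simp add: N_def)
  moreover have "countable (\<Union>i. N i)" using N by (intro countable_UN) auto
  ultimately show ?thesis using N by (intro exI[of _ "\<Union>i. N i"]) blast
qed

text \<open>
  Closing a countable basis of \<open>T0\<close> under addition, approximating sequences and witnesses of
  divisibility.
\<close>

lemma almost_divisible_cofinal:
  assumes S: "cu_semigroup S" and ad: "almost_divisible n S" and T0: "T0 \<in> Sep S"
  shows "\<exists>T\<in>Sep S. T0 \<subseteq> T \<and> almost_divisible n (S\<lparr>carrier := T\<rparr>)"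
proof -
  interpret cu_semigroup S by fact
  let ?div = "\<lambda>k u v y. y [^]\<^bsub>S\<^esub> k \<preceq>\<^bsub>S\<^esub> v \<and> u \<preceq>\<^bsub>S\<^esub> y [^]\<^bsub>S\<^esub> ((k + 1) * (n + 1))"
  have sub: "sub_cu_semigroup T0 S" using T0 by (simp add: Sep_def)
  obtain B where B: "B \<subseteq> T0" "countable B"
    and basis: "\<And>s. s \<in> T0 \<Longrightarrow> \<exists>x. range x \<subseteq> B \<and> increasing (S\<lparr>carrier := T0\<rparr>) x \<and>
                  seq_sup (S\<lparr>carrier := T0\<rparr>) x s"
    using T0 unfolding Sep_def cu_separable_def by auto
  obtain a where a: "\<And>s. s \<in> carrier S \<Longrightarrow> (\<forall>m. a s m \<lless>\<^bsub>S\<^esub> a s (Suc m)) \<and> seq_sup S (a s) s"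
    using O2 by metis
  have "\<forall>k u v. \<exists>y. u \<lless>\<^bsub>S\<^esub> v \<longrightarrow> y \<in> carrier S \<and> ?div k u v y"
    using ad unfolding almost_divisible_def by blast
  then obtain d where d: "\<And>k u v. u \<lless>\<^bsub>S\<^esub> v \<Longrightarrow> d k u v \<in> carrier S \<and> ?div k u v (d k u v)"
    by metis
  define F where
    "F u v = insert (u \<otimes>\<^bsub>S\<^esub> v) (range (a u) \<union> (if u \<lless>\<^bsub>S\<^esub> v then range (\<lambda>k. d k u v) else {}))"
    for u v
  have acar: "a s m \<in> carrier S" if "s \<in> carrier S" for s m
    by (rule way_below_carrier(1)[of S _ "a s (Suc m)"]) (use a[OF that] in simp)
  have F: "countable (F u v) \<and> F u v \<subseteq> carrier S"
    if "u \<in> carrier S" "v \<in> carrier S" for u v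
    unfolding F_def using that acar[OF that(1)] d[THEN conjunct1] by (simp add: image_subset_iff)
  have "countable (insert \<one>\<^bsub>S\<^esub> B)" "insert \<one>\<^bsub>S\<^esub> B \<subseteq> carrier S"
    using B sub_cu_subset[OF sub] by auto
  then have "\<exists>M. countable M \<and> insert \<one>\<^bsub>S\<^esub> B \<subseteq> M \<and> M \<subseteq> carrier S \<and>
      (\<forall>u\<in>M. \<forall>v\<in>M. F u v \<subseteq> M)"
    using F by (rule countable_closed_superset)
  then obtain M where M: "countable M" "insert \<one>\<^bsub>S\<^esub> B \<subseteq> M" "M \<subseteq> carrier S"
    and closed: "\<And>u v. \<lbrakk>u \<in> M; v \<in> M\<rbrakk> \<Longrightarrow> F u v \<subseteq> M"
    by (elim exE conjE) simp
  have "submonoid M S"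
  proof
    show "u \<otimes>\<^bsub>S\<^esub> v \<in> M" if "u \<in> M" "v \<in> M" for u v
      using closed[OF that] by (simp add: F_def)
  qed (use M in auto)
  moreover have "\<exists>b. range b \<subseteq> M \<and> (\<forall>m. b m \<lless>\<^bsub>S\<^esub> b (Suc m)) \<and> seq_sup S b x"
    if x: "x \<in> M" for x
    using closed[OF x x] a[OF subsetD[OF M(3) x]] unfolding F_def
    by (intro exI[of _ "a x"] conjI) blast+
  ultimately interpret cu_generating S M
    by (intro cu_generating.intro cu_generating_axioms.intro cu_semigroup_axioms)
  have "almost_divisible n SH"
  proof (rule almost_divisible_closure)
    fix k u v
    assume uv: "u \<in> M" "v \<in> M" "u \<lless>\<^bsub>S\<^esub> v"
    have "d k u v \<in> M" using closed[OF uv(1,2)] uv(3) by (auto simp: F_def)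
    then show "\<exists>y\<in>H. ?div k u v y" using d[OF uv(3)] M_subset_H by blast
  qed
  moreover have "T0 \<subseteq> H"
  proof
    fix s assume "s \<in> T0"
    then obtain x where x: "range x \<subseteq> B" "increasing (S\<lparr>carrier := T0\<rparr>) x"
        "seq_sup (S\<lparr>carrier := T0\<rparr>) x s"
      using basis by blast
    have "range x \<subseteq> M" using x(1) M(2) by blast
    moreover have "increasing S x" using x(2) sub_cu_increasing[OF sub] by blast
    moreover have "seq_sup S x s" using cu_morphismD(4)[OF sub_cu_incl[OF sub] x(2,3)] .
    ultimately show "s \<in> H" by (rule seq_closureI)
  qed
  ultimately show ?thesis using countable_generating_in_Sep[OF M(1)] by blast
qed

lemma almost_divisible_Loewenheim_Skolem: "Loewenheim_Skolem (almost_divisible n)"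
  unfolding Loewenheim_Skolem_def
proof (intro allI impI)
  fix S :: "'a po_monoid"
  assume S: "cu_semigroup S \<and> almost_divisible n S"
  let ?D = "{T \<in> Sep S. almost_divisible n (S\<lparr>carrier := T\<rparr>)}"
  have "Sep_sup S D' \<in> ?D" if "D' \<subseteq> ?D" "countable D'" "directed_family D'" for D'
    using that S Sep_sup_in_Sep[of S D'] almost_divisible_Sep_sup[of S D' n] by blast
  then have "club S ?D"
    unfolding club_def using S almost_divisible_cofinal[of S n] by blast
  then show "\<exists>D. club S D \<and> (\<forall>T\<in>D. almost_divisible n (S\<lparr>carrier := T\<rparr>))" by blast
qed


section \<open>Divisibility in inductive limits\<close>

lemma cu_morphism_nat_pow:
  assumes f: "cu_morphism S T f" and S: "monoid S" and x: "x \<in> carrier S"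
  shows "f (x [^]\<^bsub>S\<^esub> (k::nat)) = f x [^]\<^bsub>T\<^esub> k"
proof (induction k)
  case 0
  show ?case using cu_morphismD(2)[OF f] by (simp add: nat_pow_def)
next
  case (Suc k)
  then show ?case
    using cu_morphismD(7)[OF f monoid.nat_pow_closed[OF S x] x] by (simp add: nat_pow_def)
qed

text \<open>
  The images of a \<open>\<lless>\<close>-increasing sequence with supremum \<open>b\<close> have supremum \<open>f b\<close>, so that
  some \<open>b' \<lless> b\<close> in \<open>S\<close> has an image above \<open>x'\<close>; divisibility of \<open>S\<close> is used for this pair.
\<close>

lemma almost_divisible_morphism_image:
  assumes S: "cu_semigroup S" and T: "cu_semigroup T" and f: "cu_morphism S T f"
    and ad: "almost_divisible n S" and b: "b \<in> carrier S" and wb: "x' \<lless>\<^bsub>T\<^esub> f b"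
  shows "\<exists>y\<in>carrier S. f y [^]\<^bsub>T\<^esub> (k::nat) \<preceq>\<^bsub>T\<^esub> f b \<and> x' \<preceq>\<^bsub>T\<^esub> f y [^]\<^bsub>T\<^esub> ((k + 1) * (n + 1))"
proof -
  interpret S: cu_semigroup S by fact
  interpret T: cu_semigroup T by fact
  obtain a where a: "\<forall>m. a m \<lless>\<^bsub>S\<^esub> a (Suc m)" "seq_sup S a b" using S.O2[OF b] by blast
  have inc: "increasing S a" using cu_way_below_increasing[OF S a(1)] .
  obtain m where m: "x' \<preceq>\<^bsub>T\<^esub> f (a m)"
    using way_belowD[OF wb cu_morphism_increasing[OF f inc] cu_morphismD(4)[OF f inc a(2)]]
      T.leq_refl way_below_carrier(2)[OF wb] by blast
  have "a m \<lless>\<^bsub>S\<^esub> b" using S.way_below_sup a by blast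
  then obtain y where y: "y \<in> carrier S" "y [^]\<^bsub>S\<^esub> k \<preceq>\<^bsub>S\<^esub> b"
      "a m \<preceq>\<^bsub>S\<^esub> y [^]\<^bsub>S\<^esub> ((k + 1) * (n + 1))"
    using ad unfolding almost_divisible_def by blast
  note pow = cu_morphism_nat_pow[OF f S.monoid_axioms y(1)]
  have am: "a m \<in> carrier S" using inc by (rule increasing_carrier)
  have "f y [^]\<^bsub>T\<^esub> k \<preceq>\<^bsub>T\<^esub> f b"
    using cu_morphismD(3)[OF f S.nat_pow_closed[OF y(1)] b y(2)] by (simp only: pow)
  moreover have "f (a m) \<preceq>\<^bsub>T\<^esub> f y [^]\<^bsub>T\<^esub> ((k + 1) * (n + 1))"
    using cu_morphismD(3)[OF f am S.nat_pow_closed[OF y(1)] y(3)] by (simp only: pow)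
  then have "x' \<preceq>\<^bsub>T\<^esub> f y [^]\<^bsub>T\<^esub> ((k + 1) * (n + 1))"
    using T.leq_trans[OF way_below_carrier(1)[OF wb] cu_morphismD(6)[OF f am]
        T.nat_pow_closed[OF cu_morphismD(6)[OF f y(1)]] m] by blast
  ultimately show ?thesis using y(1) by blast
qed

lemma almost_divisible_inductive_limit:
  assumes lim: "inductive_limit I r S \<phi> L f" and ad: "\<And>i. i \<in> I \<Longrightarrow> almost_divisible n (S i)"
  shows "almost_divisible n L"
proof -
  have sys: "inductive_system I r S \<phi>" and L: "cu_semigroup L" and f: "cocone I r S \<phi> L f"
    using lim unfolding inductive_limit_def by auto
  interpret cu_generating L "cocone_image I S f" by (rule cocone_generating[OF sys L f])
  have "almost_divisible n SH"
  proof (rule almost_divisible_closure)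
    fix k :: nat and u v
    assume "v \<in> cocone_image I S f" and wb: "u \<lless>\<^bsub>L\<^esub> v"
    then obtain i b where i: "i \<in> I" "b \<in> carrier (S i)" "v = f i b"
      unfolding cocone_image_def by blast
    have "cu_semigroup (S i)" "cu_morphism (S i) L (f i)"
      using sys f i(1) unfolding inductive_system_def cocone_def by blast+
    then obtain y where "y \<in> carrier (S i)" "f i y [^]\<^bsub>L\<^esub> k \<preceq>\<^bsub>L\<^esub> v"
        "u \<preceq>\<^bsub>L\<^esub> f i y [^]\<^bsub>L\<^esub> ((k + 1) * (n + 1))"
      using almost_divisible_morphism_image[OF _ L _ ad[OF i(1)] i(2)] wb i(3) by blast
    moreover from this(1) have "f i y \<in> H"
      using M_subset_H i(1) unfolding cocone_image_def by blast
    ultimately show "\<exists>y\<in>H. y [^]\<^bsub>L\<^esub> k \<preceq>\<^bsub>L\<^esub> v \<and> u \<preceq>\<^bsub>L\<^esub> y [^]\<^bsub>L\<^esub> ((k + 1) * (n + 1))" by blast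
  qed
  then show ?thesis by (simp add: inductive_limit_generated[OF lim])
qed

theorem proposition3p6:
  fixes n :: nat
  shows "separably_determined TYPE('i) (almost_divisible n :: 'a po_monoid \<Rightarrow> bool)"
  unfolding separably_determined_def passes_to_inductive_limits_def
  using almost_divisible_Loewenheim_Skolem almost_divisible_inductive_limit by blast

end
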